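(* Let $X$ be a Banach lattice and let $(I(t))_{t\ge0}$ be a family of convex monotone operators $I(t)\colon X\to X$ which is BL-admissible with base point $x_0=0$ (see context). Assume that the Lipschitz set $\mathcal{L}^I$ is dense in $X$. Then for all $x,y\in X$ and every $\varepsilon>0$ there exists $t_0>0$ such that $$\left\|\frac{I(2^{-n})^k(x+2^{-n}y)-I(2^{-n})^kx}{2^{-n}}-y\right\|\le\varepsilon\quad\text{for all } k,n\in\mathbb{N}\text{ with } k2^{-n}\le t_0.$$
   Context: $\mathbb{N}=\{1,2,\dots\}$, $\mathbb{R}_+=[0,\infty)$; $B(x,r)$ is the closed ball of radius $r$ around $x$; $I(2^{-n})^k$ is the $k$-fold composition. An operator $J\colon X\to X$ is monotone if $Jx\le Jy$ whenever $x\le y$, and convex if $J(\lambda x+(1-\lambda)y)\le\lambda Jx+(1-\lambda)Jy$ for all $x,y\in X$, $\lambda\in[0,1]$. BL-admissible with base point $x_0=0$ means: (i) $I(0)=\mathrm{id}_X$; (ii) there is a function $\alpha\colon\mathbb{R}_+\times\mathbb{R}_+\to\mathbb{R}_+$, non-decreasing in the second argument, with $\alpha(\alpha(r,s),t)\le\alpha(r,s+t)$ for all $r,s,t\ge0$, such that $I(t)$ maps $B(0,r)$ into $B(0,\alpha(r,t))$ for all $r,t\ge0$; (iii) for every $r\ge0$ there is $\omega_r\ge0$ with $\|I(t)x-I(t)y\|\le e^{t\omega_r}\|x-y\|$ for all $t\in[0,1]$ and $x,y\in B(0,r)$. The Lipschitz set $\mathcal{L}^I$ is the set of all $x\in X$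 for which there exist $t_0>0$ and $c\ge0$ with $\|I(t)x-x\|\le ct$ for all $t\in[0,t_0]$. *)

theory Defs
  imports "HOL-Analysis.Analysis" "HOL-Library.Lattice_Algebras"
begin

(* The class lattice_ab_group_add_abs fixes the modulus by \<bar>x\<bar> = sup x (- x). *)
class banach_lattice = banach + ordered_real_vector + lattice_ab_group_add_abs +
  assumes norm_mono_abs: "\<bar>x\<bar> \<le> \<bar>y\<bar> \<Longrightarrow> norm x \<le> norm y"

instance real :: banach_lattice
  by standard simp

(* The library's convex_on is restricted to real-valued functions. *)
definition convex_operator :: "('a::ordered_real_vector \<Rightarrow> 'a) \<Rightarrow> bool" where
  "convex_operator J \<longleftrightarrow>
     (\<forall>x y. \<forall>l\<in>{0..1}. J (l *\<^sub>R x + (1 - l) *\<^sub>R y) \<le> l *\<^sub>R J x + (1 - l) *\<^sub>R J y)"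

(* A family (I t) indexed by t \<ge> 0 is encoded as a function on all reals; its values at
   negative t, and those of alpha at negative arguments, play no role.
   The base point is 0. *)
definition BL_admissible :: "(real \<Rightarrow> 'a::real_normed_vector \<Rightarrow> 'a) \<Rightarrow> bool" where
  "BL_admissible I \<longleftrightarrow>
     I 0 = id \<and>
     (\<exists>\<alpha> :: real \<Rightarrow> real \<Rightarrow> real.
        (\<forall>r\<ge>0. \<forall>t\<ge>0. 0 \<le> \<alpha> r t) \<and>
        (\<forall>r\<ge>0. mono_on {0..} (\<alpha> r)) \<and>
        (\<forall>r\<ge>0. \<forall>s\<ge>0. \<forall>t\<ge>0. \<alpha> (\<alpha> r s) t \<le> \<alpha> r (s + t)) \<and>
        (\<forall>r\<ge>0. \<forall>t\<ge>0. I t ` cball 0 r \<subseteq> cball 0 (\<alpha> r t))) \<and>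
     (\<forall>r\<ge>0. \<exists>\<omega>\<ge>0. \<forall>t\<in>{0..1}. \<forall>x\<in>cball 0 r. \<forall>y\<in>cball 0 r.
        norm (I t x - I t y) \<le> exp (t * \<omega>) * norm (x - y))"

definition lipschitz_set :: "(real \<Rightarrow> 'a::real_normed_vector \<Rightarrow> 'a) \<Rightarrow> 'a set" where
  "lipschitz_set I = {x. \<exists>t0>0. \<exists>c\<ge>0. \<forall>t\<in>{0..t0}. norm (I t x - x) \<le> c * t}"

end

theory Submission
  imports Defs
begin

text \<open>
  Write \<open>F\<close> for the iterate \<open>I(h)\<^sup>k\<close> with \<open>h = 2\<^sup>-\<^sup>n \<le> 1\<close>. It is convex and monotone, so its
  difference quotients increase with the step size. Comparing the step \<open>h\<close> with the
  fixed steps \<open>1\<close> and \<open>-1\<close> gives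
  \<open>F x - F (x - y) \<le> (F (x + h y) - F x) / h \<le> F (x + y) - F x\<close>
  (\<open>convex_operator_difference_quotient\<close>).
  The small denominator has disappeared, and both outer terms tend to \<open>y\<close> as soon as
  \<open>F z \<longrightarrow> z\<close> for the three fixed points \<open>z = x - y, x, x + y\<close>. In a Banach lattice the
  norm of the middle term minus \<open>y\<close> is controlled by those of the outer terms minus \<open>y\<close>
  (\<open>norm_le_of_order_interval\<close>).

  It remains to see that \<open>I(h)\<^sup>k z \<longrightarrow> z\<close> as \<open>k h \<longrightarrow> 0\<close>, uniformly in the way the time
  \<open>k h\<close> is split into steps (\<open>BL_admissible_iterates_continuous\<close>). Admissibility makes
  the iterates up to time \<open>1\<close> uniformly Lipschitz on bounded sets, so it suffices to
  check this for \<open>z\<close> in the dense Lipschitz set, where the errors \<open>c h\<close> of the single steps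
  add up to at most a constant times \<open>k h\<close>.
\<close>

section \<open>Order bounds in Banach lattices\<close>

lemma norm_abs_le: "norm \<bar>u\<bar> \<le> norm (u :: 'a::banach_lattice)"
  by (rule norm_mono_abs) simp

lemma norm_le_of_order_interval:
  fixes a b d :: "'a::banach_lattice"
  assumes "a \<le> d" "d \<le> b"
  shows "norm d \<le> norm a + norm b"
proof -
  have "d \<le> \<bar>a\<bar> + \<bar>b\<bar>"
    using assms(2) abs_ge_self[of b] abs_ge_zero[of a]
    by (metis add.left_neutral add_mono order_trans)
  moreover have "- d \<le> \<bar>a\<bar> + \<bar>b\<bar>"
    using assms(1) abs_ge_minus_self[of a] abs_ge_zero[of b]
    by (metis add.right_neutral add_mono neg_le_iff_le order_trans)
  ultimately have "\<bar>d\<bar> \<le> \<bar>a\<bar> + \<bar>b\<bar>" by (rule abs_leI)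
  then have "\<bar>d\<bar> \<le> \<bar>\<bar>a\<bar> + \<bar>b\<bar>\<bar>" using abs_ge_self order_trans by blast
  then have "norm d \<le> norm (\<bar>a\<bar> + \<bar>b\<bar>)" by (rule norm_mono_abs)
  also have "\<dots> \<le> norm \<bar>a\<bar> + norm \<bar>b\<bar>" by (rule norm_triangle_ineq)
  also have "\<dots> \<le> norm a + norm b" by (intro add_mono norm_abs_le)
  finally show ?thesis .
qed

section \<open>Convex monotone operators\<close>

lemma convex_operatorD:
  assumes "convex_operator J" "0 \<le> l" "l \<le> 1"
  shows "J (l *\<^sub>R x + (1 - l) *\<^sub>R y) \<le> l *\<^sub>R J x + (1 - l) *\<^sub>R J y"
  using assms unfolding convex_operator_def by auto

text \<open>
  Monotonicity of the outer operator is what allows the convexity inequality of the inner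
  one to be passed through it.
\<close>

lemma convex_operator_funpow:
  assumes "convex_operator J" "mono J"
  shows "convex_operator (J ^^ k)"
proof (induction k)
  case 0
  show ?case by (simp add: convex_operator_def)
next
  case (Suc k)
  show ?case
    unfolding convex_operator_def
  proof (intro allI ballI)
    fix x y and l :: real assume l: "l \<in> {0..1}"
    have "(J ^^ Suc k) (l *\<^sub>R x + (1 - l) *\<^sub>R y)
        \<le> J (l *\<^sub>R (J ^^ k) x + (1 - l) *\<^sub>R (J ^^ k) y)"
      using l by (simp add: monoD[OF assms(2)] convex_operatorD[OF Suc])
    also have "\<dots> \<le> l *\<^sub>R (J ^^ Suc k) x + (1 - l) *\<^sub>R (J ^^ Suc k) y"
      using l by (simp add: convex_operatorD[OF assms(1)])
    finally show "(J ^^ Suc k) (l *\<^sub>R x + (1 - l) *\<^sub>R y)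
        \<le> l *\<^sub>R (J ^^ Suc k) x + (1 - l) *\<^sub>R (J ^^ Suc k) y" .
  qed
qed

lemma convex_operator_difference_quotient_upper:
  assumes "convex_operator F" "0 < h" "h \<le> 1"
  shows "(F (x + h *\<^sub>R y) - F x) /\<^sub>R h \<le> F (x + y) - F x"
proof -
  have "x + h *\<^sub>R y = h *\<^sub>R (x + y) + (1 - h) *\<^sub>R x"
    by (simp add: algebra_simps)
  then have "F (x + h *\<^sub>R y) \<le> h *\<^sub>R F (x + y) + (1 - h) *\<^sub>R F x"
    using convex_operatorD[OF assms(1), of h "x + y" x] assms(2,3) by simp
  then have "F (x + h *\<^sub>R y) - F x \<le> h *\<^sub>R (F (x + y) - F x)"
    by (simp add: algebra_simps)
  from scaleR_left_mono[OF this, of "inverse h"] show ?thesis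
    using assms(2) by simp
qed

text \<open>
  The lower bound comes from convexity along the segment from \<open>x - y\<close> to \<open>x + h y\<close>, of
  which \<open>x\<close> is the point with weights \<open>h / (1 + h)\<close> and \<open>1 / (1 + h)\<close>.
\<close>

lemma convex_operator_difference_quotient:
  assumes "convex_operator F" "0 < h" "h \<le> 1"
  shows "F x - F (x - y) \<le> (F (x + h *\<^sub>R y) - F x) /\<^sub>R h"
    and "(F (x + h *\<^sub>R y) - F x) /\<^sub>R h \<le> F (x + y) - F x"
proof -
  show "(F (x + h *\<^sub>R y) - F x) /\<^sub>R h \<le> F (x + y) - F x"
    using assms by (rule convex_operator_difference_quotient_upper)
next
  define l where "l = h / (1 + h)"
  have l: "0 \<le> l" "l \<le> 1" "(1 + h) * l = h" "(1 + h) * (1 - l) = 1"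
    using assms(2) by (auto simp: l_def field_simps)
  have "(1 + h) *\<^sub>R (l *\<^sub>R (x - y) + (1 - l) *\<^sub>R (x + h *\<^sub>R y)) =
      h *\<^sub>R (x - y) + 1 *\<^sub>R (x + h *\<^sub>R y)"
    by (simp only: scaleR_add_right[of "1 + h"] scaleR_scaleR l)
  also have "\<dots> = (1 + h) *\<^sub>R x" by (simp add: algebra_simps)
  finally have "l *\<^sub>R (x - y) + (1 - l) *\<^sub>R (x + h *\<^sub>R y) = x"
    using assms(2) by simp
  then have "F x \<le> l *\<^sub>R F (x - y) + (1 - l) *\<^sub>R F (x + h *\<^sub>R y)"
    using convex_operatorD[OF assms(1) l(1,2), of "x - y" "x + h *\<^sub>R y"] by simp
  then have "(1 + h) *\<^sub>R F x \<le> (1 + h) *\<^sub>R (l *\<^sub>R F (x - y) + (1 - l) *\<^sub>R F (x + h *\<^sub>R y))"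
    using assms(2) by (intro scaleR_left_mono) auto
  also have "\<dots> = h *\<^sub>R F (x - y) + 1 *\<^sub>R F (x + h *\<^sub>R y)"
    by (simp only: scaleR_add_right[of "1 + h"] scaleR_scaleR l)
  finally have "h *\<^sub>R (F x - F (x - y)) \<le> F (x + h *\<^sub>R y) - F x"
    by (simp add: algebra_simps)
  from scaleR_left_mono[OF this, of "inverse h"]
  show "F x - F (x - y) \<le> (F (x + h *\<^sub>R y) - F x) /\<^sub>R h"
    using assms(2) by simp
qed

section \<open>Iterates of admissible families up to time one\<close>

text \<open>
  Because of \<open>\<alpha> (\<alpha> r s) t \<le> \<alpha> r (s + t)\<close> the radius after \<open>k\<close> steps depends only on the
  elapsed time \<open>k h\<close>, so that \<open>\<alpha> R 1\<close> serves for all step sizes.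
\<close>

lemma BL_admissible_iterates_bounded:
  fixes I :: "real \<Rightarrow> 'a::real_normed_vector \<Rightarrow> 'a"
  assumes "BL_admissible I" "0 \<le> R"
  obtains r where "0 \<le> r"
    and "\<And>h k z. 0 \<le> h \<Longrightarrow> real k * h \<le> 1 \<Longrightarrow> norm z \<le> R \<Longrightarrow> norm ((I h ^^ k) z) \<le> r"
proof -
  from assms(1) obtain \<alpha> :: "real \<Rightarrow> real \<Rightarrow> real" where I0: "I 0 = id"
    and \<alpha>: "\<forall>r\<ge>0. \<forall>t\<ge>0. 0 \<le> \<alpha> r t" "\<forall>r\<ge>0. mono_on {0..} (\<alpha> r)"
      "\<forall>r\<ge>0. \<forall>s\<ge>0. \<forall>t\<ge>0. \<alpha> (\<alpha> r s) t \<le> \<alpha> r (s + t)"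
      "\<forall>r\<ge>0. \<forall>t\<ge>0. I t ` cball 0 r \<subseteq> cball 0 (\<alpha> r t)"
    unfolding BL_admissible_def by (elim conjE exE) (rule that)
  note pos = \<alpha>(1)[rule_format] and mono = \<alpha>(2)[rule_format]
    and semi = \<alpha>(3)[rule_format]
  have maps: "I t ` cball 0 r \<subseteq> cball 0 (\<alpha> r t)" if "0 \<le> r" "0 \<le> t" for r t
    using \<alpha>(4) that by blast
  have step: "norm (I t z) \<le> \<alpha> r t" if "0 \<le> r" "0 \<le> t" "norm z \<le> r" for r t z
    using subsetD[OF maps[OF that(1,2)] imageI, of z] that(3) by simp
  have iter: "norm ((I h ^^ k) z) \<le> \<alpha> R (real k * h)" if "0 \<le> h" "norm z \<le> R" for h k z
  proof (induction k)
    case 0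
    \<comment> \<open>Here \<open>\<alpha> R 0\<close> bounds \<open>z\<close> because \<open>I 0 z = z\<close>.\<close>
    show ?case using step[of R 0 z] assms(2) that(2) I0 by simp
  next
    case (Suc k)
    have "norm ((I h ^^ Suc k) z) \<le> \<alpha> (\<alpha> R (real k * h)) h"
      using step[OF pos[OF assms(2)] \<open>0 \<le> h\<close> Suc] \<open>0 \<le> h\<close> by simp
    also have "\<dots> \<le> \<alpha> R (real k * h + h)"
      using semi assms(2) \<open>0 \<le> h\<close> by simp
    finally show ?case by (simp add: algebra_simps)
  qed
  show thesis
  proof
    show "0 \<le> \<alpha> R 1" using pos assms(2) by simp
    fix h k and z :: 'a assume *: "0 \<le> h" "real k * h \<le> 1" "norm z \<le> R"
    have "\<alpha> R (real k * h) \<le> \<alpha> R 1"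
      using mono_onD[OF mono[OF assms(2)], of "real k * h" 1] * by simp
    with iter[of h z k] * show "norm ((I h ^^ k) z) \<le> \<alpha> R 1" by simp
  qed
qed

text \<open>
  Since the orbits of bounded sets stay in one ball, a single Lipschitz rate \<open>\<omega>\<close> governs all
  steps. The second estimate is the accumulated one-step error: each step adds at most
  \<open>c h\<close> and amplifies the earlier error by \<open>exp (h \<omega>)\<close>.
\<close>

lemma BL_admissible_iterates_lipschitz:
  fixes I :: "real \<Rightarrow> 'a::real_normed_vector \<Rightarrow> 'a"
  assumes "BL_admissible I" "0 \<le> R"
  obtains \<omega> where "0 \<le> \<omega>"
    and "\<And>h k z w. 0 \<le> h \<Longrightarrow> real k * h \<le> 1 \<Longrightarrow> norm z \<le> R \<Longrightarrow> norm w \<le> R \<Longrightarrow>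
      norm ((I h ^^ k) z - (I h ^^ k) w) \<le> exp (real k * h * \<omega>) * norm (z - w)"
    and "\<And>h k z c. 0 \<le> h \<Longrightarrow> real k * h \<le> 1 \<Longrightarrow> norm z \<le> R \<Longrightarrow> 0 \<le> c \<Longrightarrow>
      norm (I h z - z) \<le> c * h \<Longrightarrow>
      norm ((I h ^^ k) z - z) \<le> exp (real k * h * \<omega>) * (c * (real k * h))"
proof -
  obtain r where r: "0 \<le> r"
    and orbit: "\<And>h k z. 0 \<le> h \<Longrightarrow> real k * h \<le> 1 \<Longrightarrow> norm z \<le> R \<Longrightarrow> norm ((I h ^^ k) z) \<le> r"
    using BL_admissible_iterates_bounded[OF assms] by blast
  from assms(1) r obtain \<omega> where \<omega>: "0 \<le> \<omega>"
    and lip: "\<And>t z w. 0 \<le> t \<Longrightarrow> t \<le> 1 \<Longrightarrow> norm z \<le> r \<Longrightarrow> norm w \<le> r \<Longrightarrow>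
      norm (I t z - I t w) \<le> exp (t * \<omega>) * norm (z - w)"
    unfolding BL_admissible_def by (auto simp: Ball_def)
  \<comment> \<open>the zeroth iterate, for which the time bound \<open>0 \<le> 1\<close> is trivial\<close>
  have R_le: "norm z \<le> r" if "norm z \<le> R" for z :: 'a
    using orbit[of 0 0 z] that by simp
  have times: "real k * h \<le> 1" "h \<le> 1" if "0 \<le> h" "real (Suc k) * h \<le> 1" for k h
  proof -
    have "real k * h + h \<le> 1" using that(2) by (simp add: algebra_simps)
    moreover have "0 \<le> real k * h" using that(1) by simp
    ultimately show "real k * h \<le> 1" "h \<le> 1" using that(1) by linarith+
  qed
  have exp_Suc: "exp (h * \<omega>) * exp (real k * h * \<omega>) = exp (real (Suc k) * h * \<omega>)" for h k
    by (simp add: exp_add[symmetric] algebra_simps)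
  show thesis
  proof
    fix h k and z w :: 'a
    assume "0 \<le> h" "real k * h \<le> 1" "norm z \<le> R" "norm w \<le> R"
    then show "norm ((I h ^^ k) z - (I h ^^ k) w) \<le> exp (real k * h * \<omega>) * norm (z - w)"
    proof (induction k)
      case 0
      show ?case by simp
    next
      case (Suc k)
      note t = times[OF Suc.prems(1,2)]
      have "norm ((I h ^^ Suc k) z - (I h ^^ Suc k) w)
          \<le> exp (h * \<omega>) * norm ((I h ^^ k) z - (I h ^^ k) w)"
        using Suc.prems t by (simp add: lip orbit)
      also have "\<dots> \<le> exp (h * \<omega>) * (exp (real k * h * \<omega>) * norm (z - w))"
        using Suc t by (intro mult_left_mono) auto
      finally show ?case by (simp only: exp_Suc mult.assoc[symmetric])
    qed
  next
    fix h k c and z :: 'a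
    assume "0 \<le> h" "real k * h \<le> 1" "norm z \<le> R" "0 \<le> c" "norm (I h z - z) \<le> c * h"
    then show "norm ((I h ^^ k) z - z) \<le> exp (real k * h * \<omega>) * (c * (real k * h))"
    proof (induction k)
      case 0
      show ?case by simp
    next
      case (Suc k)
      note t = times[OF Suc.prems(1,2)]
      have "norm ((I h ^^ Suc k) z - z) \<le> norm (I h ((I h ^^ k) z) - I h z) + norm (I h z - z)"
        using norm_triangle_ineq[of "I h ((I h ^^ k) z) - I h z" "I h z - z"] by simp
      also have "\<dots> \<le> exp (h * \<omega>) * norm ((I h ^^ k) z - z) + c * h"
        using Suc.prems t by (intro add_mono lip orbit R_le) auto
      also have "\<dots> \<le> exp (h * \<omega>) * (exp (real k * h * \<omega>) * (c * (real k * h))) + c * h"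
        using Suc t by (intro add_mono mult_left_mono) auto
      also have "\<dots> \<le> exp (real (Suc k) * h * \<omega>) * (c * (real k * h))
          + exp (real (Suc k) * h * \<omega>) * (c * h)"
      proof -
        have "1 \<le> exp (real (Suc k) * h * \<omega>)"
          using Suc.prems(1) \<omega> by simp
        from mult_right_mono[OF this, of "c * h"] Suc.prems(1,4) show ?thesis
          by (simp only: exp_Suc mult.assoc[symmetric]) simp
      qed
      finally show ?case by (simp add: algebra_simps)
    qed
  qed (rule \<omega>)
qed

lemma BL_admissible_iterates_continuous:
  fixes I :: "real \<Rightarrow> 'a::real_normed_vector \<Rightarrow> 'a"
  assumes "BL_admissible I" "closure (lipschitz_set I) = UNIV" "0 < \<delta>"
  obtains s where "0 < s"
    and "\<And>h k. 1 \<le> k \<Longrightarrow> 0 \<le> h \<Longrightarrow> real k * h \<le> s \<Longrightarrow> norm ((I h ^^ k) z - z) \<le> \<delta>"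
proof -
  define R where "R = norm z + 1"
  have R: "0 \<le> R" "norm z \<le> R" by (auto simp: R_def)
  obtain \<omega> where \<omega>: "0 \<le> \<omega>"
    and lip: "\<And>h k z w. 0 \<le> h \<Longrightarrow> real k * h \<le> 1 \<Longrightarrow> norm z \<le> R \<Longrightarrow> norm w \<le> R \<Longrightarrow>
      norm ((I h ^^ k) z - (I h ^^ k) w) \<le> exp (real k * h * \<omega>) * norm (z - w)"
    and drift: "\<And>h k z c. 0 \<le> h \<Longrightarrow> real k * h \<le> 1 \<Longrightarrow> norm z \<le> R \<Longrightarrow> 0 \<le> c \<Longrightarrow>
      norm (I h z - z) \<le> c * h \<Longrightarrow>
      norm ((I h ^^ k) z - z) \<le> exp (real k * h * \<omega>) * (c * (real k * h))"
    by (rule BL_admissible_iterates_lipschitz[OF assms(1) R(1)]) (rule that)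
  define M where "M = exp \<omega>"
  have M: "1 \<le> M" using \<omega> by (simp add: M_def)
  \<comment> \<open>The distance to the approximation \<open>w\<close> enters twice, once amplified by at most \<open>M\<close>;
    the remaining third of \<open>\<delta>\<close> is left for the motion of \<open>w\<close>.\<close>
  define \<eta> where "\<eta> = min 1 (\<delta> / (3 * M))"
  have \<eta>: "0 < \<eta>" "\<eta> \<le> 1" "M * \<eta> \<le> \<delta> / 3"
    using assms(3) M by (auto simp: \<eta>_def min_def field_simps)
  obtain w where w: "w \<in> lipschitz_set I" "norm (w - z) < \<eta>"
    using assms(2) \<eta>(1) closure_approachable[of z "lipschitz_set I"] by (auto simp: dist_norm)
  then obtain t0 c where t0: "0 < t0" and c: "0 \<le> c"
    and wc: "\<And>t. 0 \<le> t \<Longrightarrow> t \<le> t0 \<Longrightarrow> norm (I t w - w) \<le> c * t"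
    unfolding lipschitz_set_def by auto
  have wR: "norm w \<le> R"
    using w(2) \<eta>(2) norm_triangle_ineq[of z "w - z"] by (simp add: R_def)
  define s where "s = min (min 1 t0) (\<delta> / (3 * M * (c + 1)))"
  have s: "0 < s" "s \<le> 1" "s \<le> t0" and s': "s \<le> \<delta> / (3 * M * (c + 1))"
    using assms(3) M c t0 by (auto simp: s_def)
  have Mcs: "M * (c * s) \<le> \<delta> / 3"
  proof -
    have "M * (c * s) \<le> M * ((c + 1) * s)"
      using M s(1) by (intro mult_left_mono mult_right_mono) auto
    also have "\<dots> \<le> M * ((c + 1) * (\<delta> / (3 * M * (c + 1))))"
      using M c s' by (intro mult_left_mono) auto
    also have "\<dots> = \<delta> / 3" using M c by (simp add: divide_simps)
    finally show ?thesis .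
  qed
  show thesis
  proof
    fix h k assume *: "(1::nat) \<le> k" "0 \<le> h" "real k * h \<le> s"
    have "1 * h \<le> real k * h" using * by (intro mult_right_mono) auto
    then have h: "h \<le> t0" and kh: "real k * h \<le> 1" using * s by auto
    have E: "exp (real k * h * \<omega>) \<le> M"
      using kh \<omega> * by (simp add: M_def mult_left_le_one_le)
    let ?F = "I h ^^ k"
    have "norm (?F z - ?F w) \<le> M * \<eta>"
      using lip[OF *(2) kh R(2) wR] mult_mono[OF E, of "norm (z - w)" \<eta>] w(2) M
      by (simp add: norm_minus_commute)
    moreover have "norm (?F w - w) \<le> M * (c * s)"
    proof -
      have "norm (?F w - w) \<le> exp (real k * h * \<omega>) * (c * (real k * h))"
        using drift[OF *(2) kh wR c] wc[OF *(2) h] by simp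
      also have "\<dots> \<le> M * (c * s)"
        using E * c M by (intro mult_mono) auto
      finally show ?thesis .
    qed
    moreover have "norm (w - z) \<le> M * \<eta>"
      using w(2) mult_right_mono[OF M, of \<eta>] \<eta>(1) by linarith
    moreover have "norm (?F z - z) \<le> norm (?F z - ?F w) + norm (?F w - w) + norm (w - z)"
      using norm_triangle_ineq[of "?F z - ?F w" "?F w - w"]
        norm_triangle_ineq[of "?F z - w" "w - z"] by simp
    ultimately show "norm (?F z - z) \<le> \<delta>" using \<eta>(3) Mcs by linarith
  qed (rule s(1))
qed

section \<open>Difference quotients of the iterates\<close>

theorem lemma4p4:
  fixes I :: "real \<Rightarrow> 'a::banach_lattice \<Rightarrow> 'a"
    and x y :: 'a and \<epsilon> :: real
  assumes "\<And>t. t \<ge> 0 \<Longrightarrow> convex_operator (I t)"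
    and "\<And>t. t \<ge> 0 \<Longrightarrow> mono (I t)"
    and "BL_admissible I"
    and "closure (lipschitz_set I) = UNIV"
    and "\<epsilon> > 0"
  shows "\<exists>t0>0. \<forall>k\<ge>1. \<forall>n\<ge>1. real k * (1/2)^n \<le> t0 \<longrightarrow>
    norm (((I ((1/2)^n) ^^ k) (x + (1/2)^n *\<^sub>R y) - (I ((1/2)^n) ^^ k) x) /\<^sub>R (1/2)^n - y) \<le> \<epsilon>"
proof -
  \<comment> \<open>Each of the two outer difference quotients contributes two errors, hence the quarter.\<close>
  have "0 < \<epsilon> / 4" using assms(5) by simp
  note cont = BL_admissible_iterates_continuous[OF assms(3,4) this]
  obtain s1 where s1: "0 < s1" "\<And>h k. 1 \<le> k \<Longrightarrow> 0 \<le> h \<Longrightarrow> real k * h \<le> s1 \<Longrightarrow>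
      norm ((I h ^^ k) x - x) \<le> \<epsilon> / 4"
    using cont[where z = x] by blast
  obtain s2 where s2: "0 < s2" "\<And>h k. 1 \<le> k \<Longrightarrow> 0 \<le> h \<Longrightarrow> real k * h \<le> s2 \<Longrightarrow>
      norm ((I h ^^ k) (x + y) - (x + y)) \<le> \<epsilon> / 4"
    using cont[where z = "x + y"] by blast
  obtain s3 where s3: "0 < s3" "\<And>h k. 1 \<le> k \<Longrightarrow> 0 \<le> h \<Longrightarrow> real k * h \<le> s3 \<Longrightarrow>
      norm ((I h ^^ k) (x - y) - (x - y)) \<le> \<epsilon> / 4"
    using cont[where z = "x - y"] by blast
  show ?thesis
  proof (intro exI[of _ "min s1 (min s2 s3)"] conjI allI impI)
    show "0 < min s1 (min s2 s3)" using s1 s2 s3 by simp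
    fix k n :: nat
    assume k: "1 \<le> k" and le: "real k * (1/2)^n \<le> min s1 (min s2 s3)"
    define h :: real where "h = (1/2)^n"
    have h: "0 < h" "h \<le> 1" by (auto simp: h_def power_le_one)
    define F where "F = I h ^^ k"
    have "convex_operator F"
      using assms(1,2) h unfolding F_def by (simp add: convex_operator_funpow)
    note quot = convex_operator_difference_quotient[OF this h, of x y]
    have F: "norm (F x - x) \<le> \<epsilon> / 4" "norm (F (x + y) - (x + y)) \<le> \<epsilon> / 4"
        "norm (F (x - y) - (x - y)) \<le> \<epsilon> / 4"
      using s1(2)[OF k] s2(2)[OF k] s3(2)[OF k] h le by (auto simp: F_def h_def)
    let ?D = "(F (x + h *\<^sub>R y) - F x) /\<^sub>R h"
    have "norm (?D - y) \<le> norm (F x - F (x - y) - y) + norm (F (x + y) - F x - y)"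
      using quot by (intro norm_le_of_order_interval diff_right_mono)
    also have "F x - F (x - y) - y = (F x - x) - (F (x - y) - (x - y))" by simp
    also have "F (x + y) - F x - y = (F (x + y) - (x + y)) - (F x - x)" by simp
    also have "norm ((F x - x) - (F (x - y) - (x - y))) +
        norm ((F (x + y) - (x + y)) - (F x - x)) \<le> (\<epsilon> / 4 + \<epsilon> / 4) + (\<epsilon> / 4 + \<epsilon> / 4)"
      by (intro add_mono order_trans[OF norm_triangle_ineq4] F)
    finally show "norm (((I ((1/2)^n) ^^ k) (x + (1/2)^n *\<^sub>R y) - (I ((1/2)^n) ^^ k) x)
        /\<^sub>R (1/2)^n - y) \<le> \<epsilon>"
      by (simp add: F_def h_def)
  qed
qed

end
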